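(* Let $G$ be a distribution function on $\mathbb{R}$. Then $G$ is freely max-stable if and only if $G$ is of free extreme-value type, i.e. if and only if there exist real constants $a>0$ and $b$ such that $x\mapsto G(ax+b)$ is one of the following distribution functions: (Type I, exponential) $x\mapsto (1-e^{-x})_+$; (Type II, Pareto) for some $\alpha>0$, $x\mapsto (1-x^{-\alpha})_+$ for $x>0$ and $0$ for $x\le 0$; (Type III, Beta) for some $\alpha>0$, $x\mapsto 1-|x|^{\alpha}$ for $-1\le x\le 0$, equal to $0$ for $x<-1$ and to $1$ for $x>0$.
   Context: A distribution function on $\mathbb{R}$ is $F(t)=\mu((-\infty,t])$ for a Borel probability measure $\mu$ on $\mathbb{R}$. Write $u_+=\max(u,0)$. For distribution functions $F,G$ put $F\veebar G=(F+G-1)_+$ (upper extremal free convolution); its $n$-fold iterate is $F^{\veebar n}=(nF-(n-1))_+$, equivalently $1-F^{\veebar n}=\min(n(1-F),1)$. A distribution function $F$ is freely max-stable if for every integer $n\ge 1$ there exist $a_n,b_n\in\mathbb{R}$, $a_n>0$, such that $F^{\veebar n}(a_nx+b_n)=F(x)$ for all $x\in\mathbb{R}$.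
   Formalization: G is additionally assumed not to be the distribution function of a point mass; point masses 1_{[c,∞)} satisfy (nG-(n-1))_+ = G, so they are freely max-stable but of none of the three types, and the equivalence fails for exactly these. *)

theory Defs
  imports "HOL-Probability.Probability"
begin

definition is_distribution_function :: "(real \<Rightarrow> real) \<Rightarrow> bool" where
  "is_distribution_function F \<longleftrightarrow> (\<exists>M. real_distribution M \<and> F = cdf M)"

text \<open>Distribution functions of point masses.\<close>

definition degenerate :: "(real \<Rightarrow> real) \<Rightarrow> bool" where
  "degenerate F \<longleftrightarrow> (\<exists>c. F = (\<lambda>x. if c \<le> x then 1 else 0))"

text \<open>Upper extremal free convolution.\<close>

definition free_max_conv :: "(real \<Rightarrow> real) \<Rightarrow> (real \<Rightarrow> real) \<Rightarrow> real \<Rightarrow> real" where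
  "free_max_conv F G = (\<lambda>t. max (F t + G t - 1) 0)"

text \<open>The \<open>n\<close>-fold iterate, meaningful for \<open>n \<ge> 1\<close> only: there are \<open>n\<close> copies of \<open>F\<close>,
  hence \<open>n - 1\<close> convolutions.\<close>

definition free_max_power :: "nat \<Rightarrow> (real \<Rightarrow> real) \<Rightarrow> real \<Rightarrow> real" where
  "free_max_power n F = ((\<lambda>H. free_max_conv H F) ^^ (n - 1)) F"

definition freely_max_stable :: "(real \<Rightarrow> real) \<Rightarrow> bool" where
  "freely_max_stable F \<longleftrightarrow>
     (\<forall>n\<ge>1. \<exists>a b. a > 0 \<and> (\<forall>x. free_max_power n F (a * x + b) = F x))"

definition free_exponential :: "real \<Rightarrow> real" where
  "free_exponential x = max (1 - exp (- x)) 0"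

definition free_pareto :: "real \<Rightarrow> real \<Rightarrow> real" where
  "free_pareto \<alpha> x = (if x > 0 then max (1 - x powr (- \<alpha>)) 0 else 0)"

text \<open>At \<open>x = 0\<close> the value is \<open>1\<close>, since \<open>0 powr \<alpha> = 0\<close>.\<close>

definition free_beta :: "real \<Rightarrow> real \<Rightarrow> real" where
  "free_beta \<alpha> x = (if x < -1 then 0 else if x \<le> 0 then 1 - \<bar>x\<bar> powr \<alpha> else 1)"

definition free_extreme_value_type :: "(real \<Rightarrow> real) \<Rightarrow> bool" where
  "free_extreme_value_type G \<longleftrightarrow>
     (\<exists>a b. a > 0 \<and>
        ((\<lambda>x. G (a * x + b)) = free_exponential \<or>
         (\<exists>\<alpha>>0. (\<lambda>x. G (a * x + b)) = free_pareto \<alpha>) \<or>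
         (\<exists>\<alpha>>0. (\<lambda>x. G (a * x + b)) = free_beta \<alpha>)))"

lemma free_max_power_Suc_eq:
  assumes "0 \<le> F t" "F t \<le> 1"
  shows "free_max_power (Suc n) F t = max (real (Suc n) * F t - real n) 0"
proof (induction n)
  case 0
  then show ?case using assms by (simp add: free_max_power_def)
next
  case (Suc n)
  have "free_max_power (Suc (Suc n)) F t = max (free_max_power (Suc n) F t + F t - 1) 0"
    by (simp add: free_max_power_def free_max_conv_def)
  then show ?case using Suc assms by (auto simp: max_def algebra_simps)
qed

text \<open>The closed form \<open>(n F - (n - 1))\<^sub>+\<close> of the iterate.\<close>

lemma free_max_power_eq:
  assumes "is_distribution_function F" "n \<ge> 1"
  shows "free_max_power n F t = max (real n * F t - (real n - 1)) 0"
proof -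
  obtain M where M: "real_distribution M" "F = cdf M"
    using assms(1) by (auto simp: is_distribution_function_def)
  then interpret real_distribution M by simp
  have "0 \<le> F t" "F t \<le> 1"
    using M(2) cdf_nonneg cdf_bounded_prob by auto
  then show ?thesis
    using free_max_power_Suc_eq[of F t "n - 1"] assms(2) by (simp add: of_nat_diff)
qed

text \<open>Point masses satisfy the stability equations with \<open>a = 1\<close> and \<open>b = 0\<close>, without being of
  free extreme-value type.\<close>

lemma degenerate_freely_max_stable:
  assumes "degenerate F"
  shows "freely_max_stable F"
proof -
  obtain c where F: "F = (\<lambda>x. if c \<le> x then 1 else 0)"
    using assms by (auto simp: degenerate_def)
  have "free_max_power n F x = F x" if "n \<ge> 1" for n x
    using free_max_power_Suc_eq[of F x "n - 1"] that by (auto simp: F of_nat_diff)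
  then show ?thesis
    unfolding freely_max_stable_def by (intro allI impI exI[of _ 1] exI[of _ 0]) auto
qed

lemma degenerate_not_free_extreme_value_type:
  assumes "degenerate F"
  shows "\<not> free_extreme_value_type F"
proof
  obtain c where F: "F = (\<lambda>x. if c \<le> x then 1 else 0)"
    using assms by (auto simp: degenerate_def)
  have F01: "F x = 0 \<or> F x = 1" for x by (simp add: F)
  assume "free_extreme_value_type F"
  then obtain a b where
    "(\<lambda>x. F (a * x + b)) = free_exponential \<or>
     (\<exists>\<alpha>>0. (\<lambda>x. F (a * x + b)) = free_pareto \<alpha>) \<or>
     (\<exists>\<alpha>>0. (\<lambda>x. F (a * x + b)) = free_beta \<alpha>)"
    unfolding free_extreme_value_type_def by blast
  then consider "F (a * 1 + b) = free_exponential 1"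
    | \<alpha> where "\<alpha> > 0" "F (a * 2 + b) = free_pareto \<alpha> 2"
    | \<alpha> where "\<alpha> > 0" "F (a * (- 1 / 2) + b) = free_beta \<alpha> (- 1 / 2)"
    by metis
  then show False
  proof cases
    case 1
    have "0 < free_exponential 1" "free_exponential 1 < 1"
      by (auto simp: free_exponential_def max_def)
    then show ?thesis using 1 F01[of "a * 1 + b"] by linarith
  next
    case 2
    have "2 powr (- \<alpha>) < (1::real)" using 2(1) by (simp add: powr_less_one)
    then have "0 < free_pareto \<alpha> 2" "free_pareto \<alpha> 2 < 1"
      by (auto simp: free_pareto_def max_def)
    then show ?thesis using 2(2) F01[of "a * 2 + b"] by linarith
  next
    case 3
    have "(1 / 2) powr \<alpha> < (1::real)"
      using 3(1) powr_less_mono2[of \<alpha> "1/2" 1] by simp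
    then have "0 < free_beta \<alpha> (- 1 / 2)" "free_beta \<alpha> (- 1 / 2) < 1"
      by (auto simp: free_beta_def)
    then show ?thesis using 3(2) F01[of "a * (- 1 / 2) + b"] by linarith
  qed
qed

end

theory Submission
  imports Defs
begin

text \<open>
  The idea is to invert the distribution function. Write \<open>U y\<close> for the smallest point at which the
  tail \<open>1 - G\<close> has dropped to \<open>y\<close> or below, where \<open>0 < y < 1\<close>. The relation
  \<open>U y \<le> x \<longleftrightarrow> 1 - G x \<le> y\<close> (\<open>tail_quantile_le_iff\<close>) determines both functions from each other.
  The tail of the \<open>n\<close>-fold free max-convolution is \<open>min (n (1 - G)) 1\<close>, and below level 1 the
  truncation is invisible. Stability therefore becomes an identity without truncations:
  \<open>U (y / n) = a\<^sub>n U y + b\<^sub>n\<close> for \<open>0 < y < 1\<close> (\<open>max_stable_at_iff\<close>). In the same way, \<open>G\<close> is of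
  free extreme-value type exactly when \<open>U\<close> is a positive affine image of one of \<open>- ln y\<close>,
  \<open>y\<close> to the power \<open>- 1 / \<alpha>\<close>, or minus \<open>y\<close> to the power \<open>1 / \<alpha>\<close>
  (\<open>free_extreme_value_type_iff\<close>). That these three solve the identity is immediate.

  For the converse put \<open>V t = U (exp (- t))\<close>, a nondecreasing left-continuous function on the
  positive half-line. Stability says that shifting the argument of \<open>V\<close> by \<open>ln n\<close> acts on the values
  as an increasing affine map. Composing such a shift with the inverse of another gives the same
  for shifts by logarithms of rationals, and left continuity for all real shifts \<open>s \<ge> 0\<close>:
  \<open>V (t + s) = A s V t + B s\<close>. The slopes satisfy \<open>A (s + r) = A s A r\<close>. If they are all 1, then
  \<open>B\<close> is additive and monotone, so \<open>V\<close> is affine: the exponential law. Otherwise all these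
  commuting affine maps have a common fixed point; after moving it to the origin, \<open>V\<close> satisfies
  \<open>V (t + s) = A s V t\<close> with \<open>ln A\<close> additive and monotone, so \<open>V\<close> is a multiple of an exponential,
  with a positive rate for the Pareto law and a negative rate for the Beta law
  (\<open>mono_affine_shifts_cases\<close>). A constant \<open>V\<close> would solve all the equations; it belongs to the
  point masses (\<open>tail_quantile_nonconst\<close>).
\<close>

section \<open>Affine shift equations for monotone functions\<close>

text \<open>The values at multiples of \<open>s\<close> and of 1 are known from additivity, and the integers \<open>k \<le> n s \<le> k + 1\<close>
  squeeze \<open>n f s\<close> up to the error \<open>f 1\<close>, which does not grow with \<open>n\<close>.\<close>

lemma additive_mono_imp_linear:
  fixes f :: "real \<Rightarrow> real"
  assumes mono: "\<And>s t. 0 \<le> s \<Longrightarrow> s \<le> t \<Longrightarrow> f s \<le> f t"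
    and add: "\<And>s t. 0 \<le> s \<Longrightarrow> 0 \<le> t \<Longrightarrow> f (s + t) = f s + f t"
    and "0 \<le> s"
  shows "f s = s * f 1"
proof -
  have f0: "f 0 = 0" using add[of 0 0] by simp
  have mult: "f (real n * r) = real n * f r" if "0 \<le> r" for n r
  proof (induction n)
    case (Suc n)
    have "f (real (Suc n) * r) = f (real n * r + r)" by (simp add: algebra_simps)
    then show ?case using Suc add[of "real n * r" r] that by (simp add: algebra_simps)
  qed (simp add: f0)
  have f1: "0 \<le> f 1" using mono[of 0 1] f0 by simp
  have bound: "real n * \<bar>f s - s * f 1\<bar> \<le> f 1" for n
  proof -
    define k where "k = nat \<lfloor>real n * s\<rfloor>"
    have k: "real k \<le> real n * s" "real n * s \<le> real (Suc k)"
      using \<open>0 \<le> s\<close> by (simp_all add: k_def) linarith+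
    have "real k * f 1 \<le> real n * f s"
      using mono[OF _ k(1)] mult[of 1 k] mult[of s n] \<open>0 \<le> s\<close> by simp
    moreover have "real n * f s \<le> real (Suc k) * f 1"
      using mono[OF _ k(2)] mult[of 1 "Suc k"] mult[of s n] \<open>0 \<le> s\<close> by simp
    moreover have "real k * f 1 \<le> real n * s * f 1" "real n * s * f 1 \<le> real (Suc k) * f 1"
      using k f1 by (auto intro!: mult_right_mono)
    ultimately have "\<bar>real n * f s - real n * s * f 1\<bar> \<le> f 1"
      by (simp add: algebra_simps abs_le_iff)
    moreover have "real n * \<bar>f s - s * f 1\<bar> = \<bar>real n * (f s - s * f 1)\<bar>"
      by (simp add: abs_mult)
    ultimately show ?thesis by (simp add: algebra_simps)
  qed
  have "\<bar>f s - s * f 1\<bar> \<le> 0"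
  proof (rule ccontr)
    assume "\<not> ?thesis"
    then obtain n :: nat where "f 1 < real n * \<bar>f s - s * f 1\<bar>"
      using reals_Archimedean3[of "\<bar>f s - s * f 1\<bar>"] by auto
    with bound[of n] show False by simp
  qed
  then show ?thesis by simp
qed

text \<open>A relation between increments that mentions no coefficients passes to limits directly,
  whereas the coefficients of the affine maps would first have to be shown to converge. It
  holds for shifts by \<open>ln (m / n)\<close>, since shifting further by \<open>ln n\<close> gives the shift by \<open>ln m\<close>. Such shifts below \<open>s\<close> accumulate at \<open>s\<close>, so left
  continuity suffices.\<close>

lemma log_shifts_imp_proportional_increments:
  fixes V :: "real \<Rightarrow> real"
  assumes left_cont: "\<forall>t>0. (V \<longlongrightarrow> V t) (at_left t)"
    and shift: "\<forall>n\<ge>1. \<exists>a b. 0 < a \<and> (\<forall>t>0. V (t + ln (real n)) = a * V t + b)"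
    and pos: "0 < t" "0 < u" "0 < p" "0 < q" and "0 \<le> s"
  shows "(V (t + s) - V (u + s)) * (V p - V q) = (V t - V u) * (V (p + s) - V (q + s))"
proof -
  define \<phi> where
    "\<phi> s = (V (t + s) - V (u + s)) * (V p - V q) - (V t - V u) * (V (p + s) - V (q + s))" for s
  have rational: "\<phi> (ln r) = 0" if r: "r \<in> \<rat>" "1 < r" for r
  proof -
    obtain m n where mn: "n \<noteq> 0" "r = real m / real n"
      using Rats_abs_nat_div_natE[OF r(1)] r(2) by (metis abs_of_pos less_trans zero_less_one)
    then have n: "1 \<le> n" and m: "1 \<le> m"
      using r(2) by (cases "m = 0"; simp)+
    obtain a b where ab: "0 < a" "\<And>t. 0 < t \<Longrightarrow> V (t + ln (real n)) = a * V t + b"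
      using shift n by blast
    obtain a' b' where ab': "0 < a'" "\<And>t. 0 < t \<Longrightarrow> V (t + ln (real m)) = a' * V t + b'"
      using shift m by blast
    have "ln r = ln (real m) - ln (real n)"
      using mn m n by (simp add: ln_div)
    moreover have "0 < ln r" using r by simp
    ultimately have *: "a * V (x + ln r) + b = a' * V x + b'" if "0 < x" for x
      using ab(2)[of "x + ln r"] ab'(2)[of x] that by simp
    have diff: "a * (V (x + ln r) - V (y + ln r)) = a' * (V x - V y)" if "0 < x" "0 < y" for x y
      using *[OF that(1)] *[OF that(2)] by (simp add: algebra_simps)
    have "a * \<phi> (ln r) = (a * (V (t + ln r) - V (u + ln r))) * (V p - V q)
        - (V t - V u) * (a * (V (p + ln r) - V (q + ln r)))"
      by (simp add: \<phi>_def algebra_simps)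
    also have "\<dots> = 0"
      using diff pos by simp
    finally show ?thesis using ab(1) by simp
  qed
  have lim: "((\<lambda>s. V (x + s)) \<longlongrightarrow> V (x + s)) (at_left s)" if "0 < x" "0 < s" for x s
  proof -
    have "filterlim (\<lambda>s. x + s) (at_left (x + s)) (at_left s)"
      unfolding filterlim_at
      by (auto intro!: tendsto_intros simp: eventually_at_filter)
    moreover have "(V \<longlongrightarrow> V (x + s)) (at_left (x + s))" using left_cont that by simp
    ultimately show ?thesis by (rule filterlim_compose[rotated])
  qed
  have "\<phi> s = 0"
  proof (cases "s = 0")
    case True
    then show ?thesis by (simp add: \<phi>_def)
  next
    case False
    then have s: "0 < s" using \<open>0 \<le> s\<close> by simp
    have "(\<phi> \<longlongrightarrow> \<phi> s) (at_left s)"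
      unfolding \<phi>_def by (intro tendsto_intros lim s pos)
    show ?thesis
    proof (rule ccontr)
      assume "\<phi> s \<noteq> 0"
      then have "eventually (\<lambda>x. \<phi> x \<noteq> 0) (at_left s)"
        using \<open>(\<phi> \<longlongrightarrow> \<phi> s) (at_left s)\<close> tendsto_imp_eventually_ne by blast
      then obtain b where b: "b < s" "\<And>x. b < x \<Longrightarrow> x < s \<Longrightarrow> \<phi> x \<noteq> 0"
        unfolding eventually_at_left_field by blast
      obtain r where r: "r \<in> \<rat>" "exp (max b 0) < r" "r < exp s"
        using Rats_dense_in_real[of "exp (max b 0)" "exp s"] b(1) s by auto
      have "1 < r" using r(2) one_le_exp_iff[of "max b 0"] by linarith
      moreover have "max b 0 < ln r" "ln r < s"
        using r \<open>1 < r\<close> by (metis exp_less_cancel_iff exp_ln less_trans zero_less_one)+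
      ultimately show False using b(2)[of "ln r"] rational[OF r(1)] by simp
    qed
  qed
  then show ?thesis by (simp add: \<phi>_def)
qed

text \<open>Because the shifts commute, so do the affine maps \<open>x \<mapsto> A s x + B s\<close>. Either all of them are
  translations, or one of them has a unique fixed point, which the others then share. This is
  the dichotomy between linear and exponential solutions.\<close>

lemma mono_affine_shifts_cases:
  fixes V A B :: "real \<Rightarrow> real"
  assumes mono_on: "mono_on {0<..} V"
    and affine: "\<forall>s\<ge>0. \<forall>t>0. V (t + s) = A s * V t + B s"
    and slope_pos: "\<forall>s\<ge>0. 0 < A s"
    and nonconst: "0 < t1" "0 < t2" "V t1 \<noteq> V t2"
  obtains (linear) a b where "0 < a" "\<And>t. 0 < t \<Longrightarrow> V t = a * t + b"
  | (growing) a b c where "0 < a" "0 < c" "\<And>t. 0 < t \<Longrightarrow> V t = a * exp (c * t) + b"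
  | (saturating) a b c where "0 < a" "0 < c" "\<And>t. 0 < t \<Longrightarrow> V t = a * - exp (- (c * t)) + b"
proof -
  have mono: "V s \<le> V t" if "0 < s" "s \<le> t" for s t
    using mono_onD[OF mono_on, of s t] that by simp
  have shift: "V (t + s) = A s * V t + B s" if "0 \<le> s" "0 < t" for s t
    using affine that by blast
  have A_pos: "0 < A s" if "0 \<le> s" for s
    using slope_pos that by blast
  have A_add: "A (s + r) = A s * A r" and B_add: "B (s + r) = A s * B r + B s"
    if "0 \<le> s" "0 \<le> r" for s r
  proof -
    have eq: "A (s + r) * V t + B (s + r) = A s * (A r * V t + B r) + B s" if "0 < t" for t
      using shift[of "s + r" t] shift[of s "t + r"] shift[of r t] that \<open>0 \<le> s\<close> \<open>0 \<le> r\<close>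
      by (simp add: add.commute add.left_commute)
    have "(A (s + r) - A s * A r) * (V t1 - V t2) = 0"
      using eq[OF nonconst(1)] eq[OF nonconst(2)] by (simp add: algebra_simps)
    then show "A (s + r) = A s * A r" using nonconst(3) by simp
    then show "B (s + r) = A s * B r + B s" using eq[OF nonconst(1)] by (simp add: algebra_simps)
  qed
  show ?thesis
  proof (cases "\<forall>s\<ge>0. A s = 1")
    case True
    have B_mono: "B s \<le> B r" if "0 \<le> s" "s \<le> r" for s r
      using shift[of s 1] shift[of r 1] mono[of "1 + s" "1 + r"] True that by auto
    have B_lin: "B s = s * B 1" if "0 \<le> s" for s
      using additive_mono_imp_linear[of B s] B_mono B_add True that by auto
    have V: "V t = B 1 * t + (V 1 - B 1)" if "0 < t" for t
      using shift[of 1 t] shift[of t 1] B_lin[of t] True that by (simp add: algebra_simps)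
    have "0 \<le> B 1" using mono[of 1 "1 + 1"] shift[of 1 1] True by simp
    moreover have "B 1 \<noteq> 0" using V[OF nonconst(1)] V[OF nonconst(2)] nonconst(3) by auto
    ultimately have "0 < B 1" by simp
    from linear[OF this V] show ?thesis .
  next
    case False
    then obtain s0 where s0: "0 \<le> s0" "A s0 \<noteq> 1" by blast
    \<comment> \<open>The fixed point of \<open>x \<mapsto> A s0 x + B s0\<close> is \<open>- k\<close>.\<close>
    define k where "k = B s0 / (A s0 - 1)"
    define W where "W t = V t + k" for t
    \<comment> \<open>Composing the shifts by \<open>s0\<close> and \<open>r\<close> in both orders shows that \<open>- k\<close> is fixed by the
      map for \<open>r\<close> as well.\<close>
    have B: "B r = k * (A r - 1)" if "0 \<le> r" for r
    proof -
      have "A s0 * B r + B s0 = A r * B s0 + B r"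
        using B_add[of s0 r] B_add[of r s0] that s0 by (simp add: add.commute)
      then have "B r * (A s0 - 1) = B s0 * (A r - 1)" by (simp add: algebra_simps)
      then show ?thesis using s0 by (simp add: k_def field_simps)
    qed
    have W: "W (t + s) = A s * W t" if "0 < t" "0 \<le> s" for s t
      using shift[of s t] B[of s] that by (simp add: W_def algebra_simps)
    have "W t1 \<noteq> W t2" using nonconst by (simp add: W_def)
    then obtain t0 where t0: "0 < t0" "W t0 \<noteq> 0"
      using nonconst by metis
    have W_mono: "W s \<le> W t" if "0 < s" "s \<le> t" for s t
      using mono[OF that] by (simp add: W_def)
    have ln_add: "ln (A (s + r)) = ln (A s) + ln (A r)" if "0 \<le> s" "0 \<le> r" for s r
      using A_add[OF that] A_pos[OF that(1)] A_pos[OF that(2)] by (simp add: ln_mult)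
    have A_ineq: "A s * W t0 \<le> A r * W t0" if "0 \<le> s" "s \<le> r" for s r
      using W[of t0 s] W[of t0 r] W_mono[of "t0 + s" "t0 + r"] t0 that by auto
    have lin: "ln (A s) = s * ln (A 1)" if "0 \<le> s" for s
    proof (cases "0 < W t0")
      case True
      have "ln (A s) \<le> ln (A r)" if "0 \<le> s" "s \<le> r" for s r
        using A_ineq[OF that] True A_pos[of s] A_pos[of r] that by simp
      then show ?thesis using additive_mono_imp_linear[of "\<lambda>s. ln (A s)" s] ln_add that by auto
    next
      case False
      then have "W t0 < 0" using t0 by simp
      then have "ln (A r) \<le> ln (A s)" if "0 \<le> s" "s \<le> r" for s r
        using A_ineq[OF that] A_pos[of s] A_pos[of r] that by simp
      then show ?thesis
        using additive_mono_imp_linear[of "\<lambda>s. - ln (A s)" s] ln_add that by auto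
    qed
    define c where "c = ln (A 1)"
    define K where "K = W 1 / A 1"
    have A_exp: "A s = exp (c * s)" if "0 \<le> s" for s
      using lin[OF that] A_pos[OF that] by (metis c_def exp_ln mult.commute)
    have W_exp: "W t = K * exp (c * t)" if "0 < t" for t
      \<comment> \<open>The value at \<open>t + 1\<close> is reached both from \<open>t\<close> and from 1; the equations
        concern positive arguments only, so 0 cannot serve as the starting point.\<close>
      using W[of t 1] W[of 1 t] A_exp[of t] A_pos[of 1] that
      by (simp add: K_def field_simps)
    have V: "V t = K * exp (c * t) - k" if "0 < t" for t
      using W_exp[OF that] by (simp add: W_def)
    have c0: "c \<noteq> 0" using s0 A_exp[OF s0(1)] by auto
    have K0: "K \<noteq> 0" using W_exp[OF t0(1)] t0 by auto
    have ineq: "K * exp c \<le> K * exp (c * 2)"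
      using W_mono[of 1 2] W_exp[of 1] W_exp[of 2] by simp
    show ?thesis
    proof (cases "0 < c")
      case True
      then have "exp c < exp (c * 2)" by simp
      then have "0 < K" using ineq K0 by (smt (verit) mult_less_cancel_left)
      then show ?thesis using growing[of K c "- k"] True V by auto
    next
      case False
      then have c: "c < 0" using c0 by simp
      then have "exp (c * 2) < exp c" by simp
      then have "K < 0" using ineq K0 by (smt (verit) mult_less_cancel_left)
      then show ?thesis using saturating[of "- K" "- c" "- k"] c V by auto
    qed
  qed
qed

text \<open>Two points with different values of \<open>V\<close> fix the coefficients of the affine map for every real
  shift, and proportionality of increments says that these coefficients work everywhere.\<close>

lemma mono_log_shifts_cases:
  fixes V :: "real \<Rightarrow> real"
  assumes mono_on: "mono_on {0<..} V"
    and left_cont: "\<forall>t>0. (V \<longlongrightarrow> V t) (at_left t)"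
    and shift: "\<forall>n\<ge>1. \<exists>a b. 0 < a \<and> (\<forall>t>0. V (t + ln (real n)) = a * V t + b)"
    and nonconst: "0 < t1" "0 < t2" "V t1 \<noteq> V t2"
  obtains (linear) a b where "0 < a" "\<And>t. 0 < t \<Longrightarrow> V t = a * t + b"
  | (growing) a b c where "0 < a" "0 < c" "\<And>t. 0 < t \<Longrightarrow> V t = a * exp (c * t) + b"
  | (saturating) a b c where "0 < a" "0 < c" "\<And>t. 0 < t \<Longrightarrow> V t = a * - exp (- (c * t)) + b"
proof -
  have mono: "V s \<le> V t" if "0 < s" "s \<le> t" for s t
    using mono_onD[OF mono_on, of s t] that by simp
  define A where "A s = (V (t2 + s) - V (t1 + s)) / (V t2 - V t1)" for s
  define B where "B s = V (t1 + s) - A s * V t1" for s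
  have A: "V (t + s) - V (u + s) = A s * (V t - V u)" if "0 \<le> s" "0 < t" "0 < u" for s t u
    using log_shifts_imp_proportional_increments[OF left_cont shift that(2,3) nonconst(2,1) that(1)]
      nonconst(3) by (simp add: A_def field_simps)
  have affine: "V (t + s) = A s * V t + B s" if "0 \<le> s" "0 < t" for s t
    using A[OF that nonconst(1)] by (simp add: B_def algebra_simps)
  have A_pos: "0 < A s" if s: "0 \<le> s" for s
  proof -
    have "0 \<le> A s"
    proof (cases "t1 \<le> t2")
      case True
      then show ?thesis using mono[of t1 t2] mono[of "t1 + s" "t2 + s"] nonconst s
        by (auto simp: A_def intro!: divide_nonneg_nonneg)
    next
      case False
      then show ?thesis using mono[of t2 t1] mono[of "t2 + s" "t1 + s"] nonconst s
        by (auto simp: A_def intro!: divide_nonpos_nonpos)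
    qed
    moreover have "A s \<noteq> 0"
    proof
      \<comment> \<open>A vanishing slope would make \<open>V\<close> constant on the points beyond \<open>s\<close>, against the injective
        action of the shift by the logarithm of a large integer.\<close>
      assume "A s = 0"
      obtain n :: nat where n: "exp s < real n" using reals_Archimedean2 by blast
      have n1: "1 \<le> n" using n s one_le_exp_iff[of s] by linarith
      have "s < ln (real n)" using n n1
        by (metis exp_less_cancel_iff exp_ln of_nat_0_less_iff less_le_trans zero_less_one)
      define r where "r = ln (real n) - s"
      have r: "0 \<le> r" "ln (real n) = r + s" using \<open>s < ln (real n)\<close> by (simp_all add: r_def)
      obtain a b where ab: "0 < a" "\<And>t. 0 < t \<Longrightarrow> V (t + ln (real n)) = a * V t + b"
        using shift n1 by blast
      have "V (t1 + r + s) - V (t2 + r + s) = 0"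
        using A[of s "t1 + r" "t2 + r"] \<open>A s = 0\<close> nonconst r s by simp
      then have "a * V t1 = a * V t2"
        using ab(2)[OF nonconst(1)] ab(2)[OF nonconst(2)] r by (simp add: add.assoc)
      then show False using ab(1) nonconst(3) by simp
    qed
    ultimately show ?thesis by simp
  qed
  have "\<forall>s\<ge>0. \<forall>t>0. V (t + s) = A s * V t + B s" "\<forall>s\<ge>0. 0 < A s"
    using affine A_pos by auto
  from mono_affine_shifts_cases[OF mono_on this nonconst] show ?thesis
    using linear growing saturating by metis
qed

section \<open>Tail quantiles\<close>

definition tail_quantile :: "(real \<Rightarrow> real) \<Rightarrow> real \<Rightarrow> real" where
  "tail_quantile G y = Inf {x. 1 - G x \<le> y}"

lemma distribution_function_bounds:
  assumes "is_distribution_function G"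
  shows "0 \<le> G x" "G x \<le> 1"
proof -
  obtain M where M: "real_distribution M" "G = cdf M"
    using assms by (auto simp: is_distribution_function_def)
  then interpret real_distribution M by simp
  show "0 \<le> G x" "G x \<le> 1" using M(2) cdf_nonneg cdf_bounded_prob by auto
qed

text \<open>The set of points where the tail is at most \<open>y\<close> is an up-set, nonempty since \<open>0 < y\<close> and bounded
  below since \<open>y < 1\<close>. Right continuity of \<open>G\<close> puts its infimum into it.\<close>

lemma tail_quantile_le_iff:
  assumes "is_distribution_function G" "0 < y" "y < 1"
  shows "tail_quantile G y \<le> x \<longleftrightarrow> 1 - G x \<le> y"
proof -
  obtain M where M: "real_distribution M" "G = cdf M"
    using assms by (auto simp: is_distribution_function_def)
  then interpret real_distribution M by simp
  have mono: "G u \<le> G v" if "u \<le> v" for u v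
    using cdf_nondecreasing that M(2) by auto
  let ?S = "{x. 1 - G x \<le> y}"
  have "eventually (\<lambda>x. G x > 1 - y) at_top"
    using order_tendstoD(1)[OF cdf_lim_at_top_prob, of "1 - y"] assms M(2) by simp
  then obtain u where "1 - y < G u" by (auto simp: eventually_at_top_linorder)
  then have ne: "?S \<noteq> {}" by (auto intro: exI[of _ u])
  have "eventually (\<lambda>x. G x < 1 - y) at_bot"
    using order_tendstoD(2)[OF cdf_lim_at_bot, of "1 - y"] assms M(2) by simp
  then obtain l where l: "G l < 1 - y" by (auto simp: eventually_at_bot_linorder)
  have bdd: "bdd_below ?S"
  proof (rule bdd_belowI[of _ l])
    fix x assume "x \<in> ?S"
    then show "l \<le> x" using mono[of x l] l by (cases "x \<le> l") auto
  qed
  define q where "q = tail_quantile G y"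
  have above: "1 - G x \<le> y" if "q < x" for x
  proof -
    have "\<exists>z\<in>?S. z < x"
      using that cInf_less_iff[OF ne bdd, of x] unfolding q_def tail_quantile_def by blast
    then obtain z where "1 - G z \<le> y" "z < x" by blast
    then show ?thesis using mono[of z x] by auto
  qed
  have "(G \<longlongrightarrow> G q) (at_right q)"
    using cdf_is_right_cont[of q] M(2) by (simp add: continuous_within)
  moreover have "eventually (\<lambda>x. 1 - y \<le> G x) (at_right q)"
    using above by (auto simp: eventually_at_filter algebra_simps)
  ultimately have "1 - y \<le> G q"
    by (intro tendsto_lowerbound[of G "G q" "at_right q"]) auto
  then have at: "1 - G q \<le> y" by simp
  show ?thesis
  proof
    assume "tail_quantile G y \<le> x"
    then show "1 - G x \<le> y" using at mono[of q x] by (simp add: q_def)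
  next
    assume "1 - G x \<le> y"
    then show "tail_quantile G y \<le> x"
      unfolding tail_quantile_def by (intro cInf_lower bdd) auto
  qed
qed

lemma tail_quantile_eqI:
  assumes "is_distribution_function G" "0 < y" "y < 1"
    and "\<And>x. 1 - G x \<le> y \<longleftrightarrow> q \<le> x"
  shows "tail_quantile G y = q"
proof (rule antisym)
  show "tail_quantile G y \<le> q"
    unfolding tail_quantile_le_iff[OF assms(1-3)] assms(4) by (rule order_refl)
  show "q \<le> tail_quantile G y"
    unfolding assms(4)[symmetric] tail_quantile_le_iff[OF assms(1-3), symmetric]
    by (rule order_refl)
qed

lemma tail_quantile_antimono:
  assumes "is_distribution_function G" "0 < y" "y \<le> z" "z < 1"
  shows "tail_quantile G z \<le> tail_quantile G y"
proof -
  have y: "y < 1" and z: "0 < z" using assms by linarith+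
  have "1 - G (tail_quantile G y) \<le> y"
    using tail_quantile_le_iff[OF assms(1,2) y] by blast
  then show ?thesis
    using tail_quantile_le_iff[OF assms(1) z assms(4)] \<open>y \<le> z\<close> by (meson order_trans)
qed

text \<open>Tail quantiles are right-continuous in the level \<open>y\<close>, because the strict relation
  \<open>x < U y \<longleftrightarrow> y < 1 - G x\<close> is open in \<open>y\<close>. The substitution \<open>y = exp (- t)\<close> reverses the side.\<close>

lemma tail_quantile_exp_left_cont:
  assumes G: "is_distribution_function G" and t: "0 < t"
  shows "((\<lambda>t. tail_quantile G (exp (- t))) \<longlongrightarrow> tail_quantile G (exp (- t))) (at_left t)"
proof -
  have pos: "eventually (\<lambda>s. 0 < s \<and> s < t) (at_left t)"
    using t by (auto simp: eventually_at_left_field)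
  show ?thesis
  proof (rule order_tendstoI)
    fix l assume "l < tail_quantile G (exp (- t))"
    then have "exp (- t) < 1 - G l"
      using tail_quantile_le_iff[OF G, of "exp (- t)" l] t by auto
    moreover have "((\<lambda>s. exp (- s)) \<longlongrightarrow> exp (- t)) (at_left t)"
      by (intro tendsto_intros)
    ultimately have "eventually (\<lambda>s. exp (- s) < 1 - G l) (at_left t)"
      by (rule order_tendstoD(2)[rotated])
    with pos show "eventually (\<lambda>s. l < tail_quantile G (exp (- s))) (at_left t)"
    proof eventually_elim
      case (elim s)
      then show ?case using tail_quantile_le_iff[OF G, of "exp (- s)" l] by auto
    qed
  next
    fix u assume u: "tail_quantile G (exp (- t)) < u"
    from pos show "eventually (\<lambda>s. tail_quantile G (exp (- s)) < u) (at_left t)"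
    proof eventually_elim
      case (elim s)
      then show ?case using tail_quantile_antimono[OF G, of "exp (- t)" "exp (- s)"] u by auto
    qed
  qed
qed

text \<open>Levels strictly between 0 and 1 suffice to separate two numbers of the closed unit interval.
  This is what allows a distribution function to be recovered from tail quantiles at such levels,
  where neither truncation nor infinite quantiles interfere.\<close>

lemma unit_interval_eqI:
  fixes p q :: real
  assumes "0 \<le> p" "p \<le> 1" "0 \<le> q" "q \<le> 1"
    and "\<And>y. 0 < y \<Longrightarrow> y < 1 \<Longrightarrow> p \<le> y \<longleftrightarrow> q \<le> y"
  shows "p = q"
proof -
  have "\<not> p < q" if "0 \<le> p" "q \<le> 1" "\<And>y. 0 < y \<Longrightarrow> y < 1 \<Longrightarrow> p \<le> y \<longleftrightarrow> q \<le> y" for p q :: real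
    using that(3)[of "(p + q) / 2"] that(1,2) by auto
  from this[of p q] this[of q p] show ?thesis using assms by fastforce
qed

text \<open>A constant tail quantile \<open>c\<close> means that the tail jumps from 1 to 0 at \<open>c\<close>.\<close>

lemma tail_quantile_nonconst:
  assumes G: "is_distribution_function G" and "\<not> degenerate G"
  obtains y z where "0 < y" "y < 1" "0 < z" "z < 1" "tail_quantile G y \<noteq> tail_quantile G z"
proof (rule ccontr)
  note witnesses = that
  assume "\<not> thesis"
  then have *: "tail_quantile G y = tail_quantile G (1 / 2)" if "0 < y" "y < 1" for y
    using that witnesses[of y "1 / 2"] by fastforce
  define c where "c = tail_quantile G (1 / 2)"
  have c: "tail_quantile G y = c" if "0 < y" "y < 1" for y
    unfolding c_def using * that by blast
  have "1 - G x = 1 - (if c \<le> x then 1 else 0)" for x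
  proof (rule unit_interval_eqI)
    fix y :: real assume "0 < y" "y < 1"
    then show "1 - G x \<le> y \<longleftrightarrow> 1 - (if c \<le> x then 1 else 0) \<le> y"
      using tail_quantile_le_iff[OF G, of y x] c[of y] by auto
  qed (use distribution_function_bounds[OF G, of x] in auto)
  then have "G = (\<lambda>x. if c \<le> x then 1 else 0)" by (simp add: fun_eq_iff)
  then show False using assms(2) degenerate_def by blast
qed

section \<open>Stability and type in terms of tail quantiles\<close>

text \<open>For a level \<open>y < 1\<close>, the tail \<open>min (n (1 - G)) 1\<close> is at most \<open>y\<close> exactly when \<open>1 - G\<close> is at most
  \<open>y / n\<close>. Hence the \<open>n\<close>-th power of \<open>G\<close> has tail quantile \<open>U (y / n)\<close>, and the rescaling acts on
  it as an affine map.\<close>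

lemma max_stable_at_iff:
  assumes G: "is_distribution_function G" and n: "1 \<le> n" and a: "0 < a"
  shows "(\<forall>x. free_max_power n G (a * x + b) = G x) \<longleftrightarrow>
    (\<forall>y. 0 < y \<and> y < 1 \<longrightarrow> tail_quantile G (y / real n) = a * tail_quantile G y + b)"
proof -
  have div: "0 < y / real n" "y / real n < 1" if "0 < y" "y < 1" for y
    using that n by (auto simp: divide_less_eq)
  have tail: "1 - free_max_power n G (a * x + b) \<le> y \<longleftrightarrow> tail_quantile G (y / real n) \<le> a * x + b"
    if "0 < y" "y < 1" for x y
  proof -
    have "1 - free_max_power n G (a * x + b) \<le> y \<longleftrightarrow> 1 - G (a * x + b) \<le> y / real n"
      using n that by (auto simp: free_max_power_eq[OF G n] max_def field_simps)
    then show ?thesis using tail_quantile_le_iff[OF G div[OF that]] by simp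
  qed
  show ?thesis
  proof (intro iffI allI impI)
    fix y :: real
    assume eq: "\<forall>x. free_max_power n G (a * x + b) = G x" and y: "0 < y \<and> y < 1"
    have "tail_quantile G (y / real n) \<le> a * x + b \<longleftrightarrow> a * tail_quantile G y + b \<le> a * x + b" for x
      using tail[of y x] eq y tail_quantile_le_iff[OF G, of y x] by (simp add: a)
    from this[of "(z - b) / a" for z]
    have le: "tail_quantile G (y / real n) \<le> z \<longleftrightarrow> a * tail_quantile G y + b \<le> z" for z
      using a by simp
    show "tail_quantile G (y / real n) = a * tail_quantile G y + b"
      using le[of "tail_quantile G (y / real n)"] le[of "a * tail_quantile G y + b"] by simp
  next
    fix x
    assume eq: "\<forall>y. 0 < y \<and> y < 1 \<longrightarrow> tail_quantile G (y / real n) = a * tail_quantile G y + b"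
    have "1 - free_max_power n G (a * x + b) = 1 - G x"
    proof (rule unit_interval_eqI)
      have "real n * G (a * x + b) - (real n - 1) \<le> 1"
        using mult_left_le[of "G (a * x + b)" "real n"] distribution_function_bounds[OF G]
        by simp
      then show "0 \<le> 1 - free_max_power n G (a * x + b)"
        by (simp add: free_max_power_eq[OF G n])
      show "1 - free_max_power n G (a * x + b) \<le> 1"
        by (simp add: free_max_power_eq[OF G n])
      show "1 - free_max_power n G (a * x + b) \<le> y \<longleftrightarrow> 1 - G x \<le> y" if "0 < y" "y < 1" for y
        using tail[OF that, of x] eq that tail_quantile_le_iff[OF G that, of x] by (simp add: a)
    qed (use distribution_function_bounds[OF G, of x] in auto)
    then show "free_max_power n G (a * x + b) = G x" by simp
  qed
qed

text \<open>The reference law \<open>E\<close> is described by a function \<open>u\<close> in the role of its tail quantile. An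
  increasing affine change of the argument acts on tail quantiles by the same affine map, and a
  law is determined by its tail quantiles.\<close>

lemma rescaled_eq_iff:
  assumes G: "is_distribution_function G" and a: "0 < a"
    and E: "\<And>x. 0 \<le> E x" "\<And>x. E x \<le> 1"
    and u: "\<And>x y. 0 < y \<Longrightarrow> y < 1 \<Longrightarrow> 1 - E x \<le> y \<longleftrightarrow> u y \<le> x"
  shows "(\<lambda>x. G (a * x + b)) = E \<longleftrightarrow>
    (\<forall>y. 0 < y \<and> y < 1 \<longrightarrow> tail_quantile G y = a * u y + b)"
proof (intro iffI allI impI)
  fix y :: real
  assume eq: "(\<lambda>x. G (a * x + b)) = E" and y: "0 < y \<and> y < 1"
  show "tail_quantile G y = a * u y + b"
  proof (rule tail_quantile_eqI[OF G])
    fix x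
    have "G x = E ((x - b) / a)" using fun_cong[OF eq, of "(x - b) / a"] a by simp
    then show "1 - G x \<le> y \<longleftrightarrow> a * u y + b \<le> x"
      using u[of y "(x - b) / a"] y a by (simp add: field_simps)
  qed (use y in auto)
next
  assume eq: "\<forall>y. 0 < y \<and> y < 1 \<longrightarrow> tail_quantile G y = a * u y + b"
  have "1 - G (a * x + b) = 1 - E x" for x
  proof (rule unit_interval_eqI)
    show "1 - G (a * x + b) \<le> y \<longleftrightarrow> 1 - E x \<le> y" if "0 < y" "y < 1" for y
      using tail_quantile_le_iff[OF G that, of "a * x + b"] eq that u[OF that] a by simp
  qed (use distribution_function_bounds[OF G] E in auto)
  then show "(\<lambda>x. G (a * x + b)) = E" by (simp add: fun_eq_iff)
qed

lemma free_exponential_tail: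
  assumes "0 < y" "y < 1"
  shows "1 - free_exponential x \<le> y \<longleftrightarrow> - ln y \<le> x"
proof -
  have "1 - free_exponential x \<le> y \<longleftrightarrow> exp (- x) \<le> y"
    using assms unfolding free_exponential_def by linarith
  also have "\<dots> \<longleftrightarrow> - x \<le> ln y"
    using ln_ge_iff[OF assms(1), of "- x"] by simp
  finally show ?thesis by auto
qed

lemma free_pareto_tail:
  assumes "0 < \<alpha>" "0 < y" "y < 1"
  shows "1 - free_pareto \<alpha> x \<le> y \<longleftrightarrow> y powr (- (1 / \<alpha>)) \<le> x"
proof (cases "0 < x")
  case True
  have "1 - free_pareto \<alpha> x \<le> y \<longleftrightarrow> x powr (- \<alpha>) \<le> y"
    using assms True by (simp add: free_pareto_def max_def)
  also have "\<dots> \<longleftrightarrow> - \<alpha> * ln x \<le> ln y"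
    using assms True ln_ge_iff[of y "- \<alpha> * ln x"] by (simp add: powr_def)
  also have "\<dots> \<longleftrightarrow> - (1 / \<alpha>) * ln y \<le> ln x"
    using assms by (auto simp: field_simps)
  also have "\<dots> \<longleftrightarrow> y powr (- (1 / \<alpha>)) \<le> x"
    using assms True ln_ge_iff[of x "- (1 / \<alpha>) * ln y"] by (simp add: powr_def)
  finally show ?thesis .
next
  case False
  moreover have "0 < y powr (- (1 / \<alpha>))" using assms by simp
  ultimately show ?thesis using assms by (auto simp: free_pareto_def simp del: powr_gt_zero)
qed

lemma free_beta_tail:
  assumes "0 < \<alpha>" "0 < y" "y < 1"
  shows "1 - free_beta \<alpha> x \<le> y \<longleftrightarrow> - (y powr (1 / \<alpha>)) \<le> x"
proof -
  have y1: "0 < y powr (1 / \<alpha>)" "y powr (1 / \<alpha>) < 1"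
    using assms powr_less_mono2[of "1 / \<alpha>" y 1] by auto
  consider "x < -1" | "-1 \<le> x" "x < 0" | "0 \<le> x" by linarith
  then show ?thesis
  proof cases
    case 2
    then have "1 - free_beta \<alpha> x \<le> y \<longleftrightarrow> (- x) powr \<alpha> \<le> y"
      by (simp add: free_beta_def)
    also have "\<dots> \<longleftrightarrow> \<alpha> * ln (- x) \<le> ln y"
      using assms 2 ln_ge_iff[of y "\<alpha> * ln (- x)"] by (simp add: powr_def)
    also have "\<dots> \<longleftrightarrow> ln (- x) \<le> (1 / \<alpha>) * ln y"
      using assms by (auto simp: field_simps)
    also have "\<dots> \<longleftrightarrow> - x \<le> y powr (1 / \<alpha>)"
      using assms 2 ln_le_cancel_iff[of "- x" "exp ((1 / \<alpha>) * ln y)"] by (simp add: powr_def)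
    finally show ?thesis by auto
  next
    case 3
    then have "- (y powr (1 / \<alpha>)) \<le> x" using y1 by linarith
    then show ?thesis using assms 3 by (auto simp: free_beta_def)
  qed (use assms y1 in \<open>auto simp: free_beta_def\<close>)
qed

text \<open>In these coordinates each of the three families is a single formula on \<open>0 < y < 1\<close>; the piecewise
  definitions and the endpoints of the supports have disappeared.\<close>

lemma free_extreme_value_type_iff:
  assumes G: "is_distribution_function G"
  shows "free_extreme_value_type G \<longleftrightarrow> (\<exists>a b. 0 < a \<and>
    ((\<forall>y. 0 < y \<and> y < 1 \<longrightarrow> tail_quantile G y = a * - ln y + b) \<or>
     (\<exists>\<alpha>>0. \<forall>y. 0 < y \<and> y < 1 \<longrightarrow> tail_quantile G y = a * y powr (- (1 / \<alpha>)) + b) \<or>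
     (\<exists>\<alpha>>0. \<forall>y. 0 < y \<and> y < 1 \<longrightarrow> tail_quantile G y = a * - (y powr (1 / \<alpha>)) + b)))"
proof -
  have exponential: "(\<lambda>x. G (a * x + b)) = free_exponential \<longleftrightarrow>
      (\<forall>y. 0 < y \<and> y < 1 \<longrightarrow> tail_quantile G y = a * - ln y + b)" if "0 < a" for a b
    using rescaled_eq_iff[OF G that, of free_exponential "\<lambda>y. - ln y"] free_exponential_tail
    by (simp add: free_exponential_def)
  have pareto: "(\<lambda>x. G (a * x + b)) = free_pareto \<alpha> \<longleftrightarrow>
      (\<forall>y. 0 < y \<and> y < 1 \<longrightarrow> tail_quantile G y = a * y powr (- (1 / \<alpha>)) + b)"
    if "0 < a" "0 < \<alpha>" for a b \<alpha>
    by (rule rescaled_eq_iff[OF G that(1) _ _ free_pareto_tail[OF that(2)]])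
      (auto simp: free_pareto_def)
  have beta: "(\<lambda>x. G (a * x + b)) = free_beta \<alpha> \<longleftrightarrow>
      (\<forall>y. 0 < y \<and> y < 1 \<longrightarrow> tail_quantile G y = a * - (y powr (1 / \<alpha>)) + b)"
    if "0 < a" "0 < \<alpha>" for a b \<alpha>
    using that(2)
    by (intro rescaled_eq_iff[OF G that(1) _ _ free_beta_tail[OF that(2)]])
      (auto simp: free_beta_def powr_le1)
  show ?thesis
    unfolding free_extreme_value_type_def
    by (intro ex_cong1 conj_cong disj_cong refl exponential pareto beta)
qed

section \<open>Freely max-stable laws\<close>

theorem theorem6p8:
  fixes G :: "real \<Rightarrow> real"
  assumes "is_distribution_function G"
    and "\<not> degenerate G"
  shows "freely_max_stable G \<longleftrightarrow> free_extreme_value_type G"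
proof -
  note G = assms(1)
  let ?U = "tail_quantile G"
  have stable_iff: "freely_max_stable G \<longleftrightarrow> (\<forall>n\<ge>1. \<exists>a b. 0 < a \<and>
      (\<forall>y. 0 < y \<and> y < 1 \<longrightarrow> ?U (y / real n) = a * ?U y + b))"
    unfolding freely_max_stable_def using max_stable_at_iff[OF G] by metis
  show ?thesis
  proof
    assume stable: "freely_max_stable G"
    define V where "V t = ?U (exp (- t))" for t
    have U: "?U y = V (- ln y)" if "0 < y" for y using that by (simp add: V_def)
    have mono: "mono_on {0<..} V"
      using tail_quantile_antimono[OF G] by (intro mono_onI) (simp add: V_def)
    have left_cont: "\<forall>t>0. (V \<longlongrightarrow> V t) (at_left t)"
      using tail_quantile_exp_left_cont[OF G] unfolding V_def by blast
    have shift: "\<forall>n\<ge>1. \<exists>a b. 0 < a \<and> (\<forall>t>0. V (t + ln (real n)) = a * V t + b)"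
    proof (intro allI impI)
      fix n :: nat assume n: "1 \<le> n"
      have "exp (- (t + ln (real n))) = exp (- t) / real n" for t
        using n by (simp add: exp_diff exp_minus field_simps)
      then have "V (t + ln (real n)) = ?U (exp (- t) / real n)" for t by (simp add: V_def)
      moreover obtain a b where "0 < a" "\<And>y. 0 < y \<Longrightarrow> y < 1 \<Longrightarrow> ?U (y / real n) = a * ?U y + b"
        using stable stable_iff n by blast
      ultimately have "0 < a \<and> (\<forall>t>0. V (t + ln (real n)) = a * V t + b)"
        by (simp add: V_def)
      then show "\<exists>a b. 0 < a \<and> (\<forall>t>0. V (t + ln (real n)) = a * V t + b)" by blast
    qed
    obtain y z where yz: "0 < y" "y < 1" "0 < z" "z < 1" "?U y \<noteq> ?U z"
      using tail_quantile_nonconst[OF assms] .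
    have nonconst: "0 < - ln y" "0 < - ln z" "V (- ln y) \<noteq> V (- ln z)"
      using yz U by auto
    show "free_extreme_value_type G"
      using mono left_cont shift nonconst
    proof (cases rule: mono_log_shifts_cases)
      case (linear a b)
      then have "\<forall>y. 0 < y \<and> y < 1 \<longrightarrow> ?U y = a * - ln y + b" using U by simp
      then show ?thesis using free_extreme_value_type_iff[OF G] linear(1) by blast
    next
      case (growing a b c)
      \<comment> \<open>The growth rate in \<open>t\<close> is the reciprocal of the index \<open>\<alpha>\<close>.\<close>
      have "\<forall>y. 0 < y \<and> y < 1 \<longrightarrow> ?U y = a * y powr (- (1 / (1 / c))) + b"
        using U growing(3) by (simp add: powr_def)
      moreover have "0 < 1 / c" using growing(2) by simp
      ultimately show ?thesis using free_extreme_value_type_iff[OF G] growing(1) by blast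
    next
      case (saturating a b c)
      have "\<forall>y. 0 < y \<and> y < 1 \<longrightarrow> ?U y = a * - (y powr (1 / (1 / c))) + b"
        using U saturating(3) by (simp add: powr_def)
      moreover have "0 < 1 / c" using saturating(2) by simp
      ultimately show ?thesis using free_extreme_value_type_iff[OF G] saturating(1) by blast
    qed
  next
    assume "free_extreme_value_type G"
    then obtain a b where a: "0 < a" and
      cases: "(\<forall>y. 0 < y \<and> y < 1 \<longrightarrow> ?U y = a * - ln y + b) \<or>
       (\<exists>\<alpha>>0. \<forall>y. 0 < y \<and> y < 1 \<longrightarrow> ?U y = a * y powr (- (1 / \<alpha>)) + b) \<or>
       (\<exists>\<alpha>>0. \<forall>y. 0 < y \<and> y < 1 \<longrightarrow> ?U y = a * - (y powr (1 / \<alpha>)) + b)"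
      unfolding free_extreme_value_type_iff[OF G] by blast
    show "freely_max_stable G"
      unfolding stable_iff
    proof (intro allI impI)
      fix n :: nat assume n: "1 \<le> n"
      have div: "0 < y / real n \<and> y / real n < 1" if "0 < y \<and> y < 1" for y
        using that n by (auto simp: divide_less_eq)
      \<comment> \<open>Pareto and Beta quantiles are both multiples of a power of \<open>y\<close>, shifted by \<open>b\<close>: dividing
        the level by \<open>n\<close> scales around \<open>b\<close>.\<close>
      have power: "\<exists>a' b'. 0 < a' \<and> (\<forall>y. 0 < y \<and> y < 1 \<longrightarrow> ?U (y / real n) = a' * ?U y + b')"
        if eq: "\<And>y. 0 < y \<and> y < 1 \<Longrightarrow> ?U y = k * y powr p + b" for k p
      proof (intro exI conjI allI impI)
        show "0 < real n powr (- p)" using n by simp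
        fix y :: real assume y: "0 < y \<and> y < 1"
        have "(y / real n) powr p = real n powr (- p) * y powr p"
          using y n by (simp add: powr_divide powr_minus field_simps)
        then show "?U (y / real n) = real n powr (- p) * ?U y + (b - real n powr (- p) * b)"
          using eq[OF y] eq[OF div[OF y]] by (simp add: algebra_simps)
      qed
      from cases consider
          (exponential) "\<And>y. 0 < y \<and> y < 1 \<Longrightarrow> ?U y = a * - ln y + b"
        | (pareto) \<alpha> where "\<And>y. 0 < y \<and> y < 1 \<Longrightarrow> ?U y = a * y powr (- (1 / \<alpha>)) + b"
        | (beta) \<alpha> where "\<And>y. 0 < y \<and> y < 1 \<Longrightarrow> ?U y = (- a) * y powr (1 / \<alpha>) + b"
        by auto
      then show "\<exists>a b. 0 < a \<and> (\<forall>y. 0 < y \<and> y < 1 \<longrightarrow> ?U (y / real n) = a * ?U y + b)"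
      proof cases
        case exponential
        have "?U (y / real n) = 1 * ?U y + a * ln (real n)" if "0 < y \<and> y < 1" for y
          using exponential[OF that] exponential[OF div[OF that]] that n
          by (simp add: ln_div algebra_simps)
        then show ?thesis by (meson zero_less_one)
      qed (rule power, assumption)+
    qed
  qed
qed

end
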